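(* Let $q$ be a prime power, $m$ a positive integer, $t\ge 2$ an integer, and let $f:\mathbb{F}_q^m\to\mathbb{F}_q$ be the polynomial function $f(\mathbf{x})=\sum_{j=1}^t a_jg_j(\mathbf{x})$, where $a_j\in\mathbb{F}_q^*$ and the $g_j(\mathbf{x})$ are monomials in $x_1,\dots,x_m$. If (1) the sets $s(g_1),\dots,s(g_t)$ are (pairwise) disjoint, (2) $\#s(g_j)\ge 2$ for all $1\le j\le t$, and (3) for each $j$, writing $g_j(\mathbf{x})=\prod_{i=1}^m x_i^{b_i}$, one has $b_i\in\{0,1\}$ for all $1\le i\le m$, then $\mathcal{C}_f$ is a $[q^m-1,m+1]_q$ minimal linear code.
   Context: For a monomial $g(\mathbf{x})=\prod_{i=1}^m x_i^{b_i}$ (with nonnegative integer exponents $b_i$), $s(g)=\{i : 1\le i\le m,\ b_i\neq 0\}$. Write $\mathbf{x}\cdot\mathbf{y}=\sum_i x_iy_i$. For $f:\mathbb{F}_q^m\to\mathbb{F}_q$, $\mathcal{C}_f=\{(uf(\mathbf{x})+\mathbf{v}\cdot\mathbf{x})_{\mathbf{x}\in\mathbb{F}_q^m\setminus\{\mathbf{0}\}} : u\in\mathbb{F}_q,\ \mathbf{v}\in\mathbb{F}_q^m\}\subseteq\mathbb{F}_q^{q^m-1}$. An $[n,k]_q$ linear code is a $k$-dimensional subspace of $\mathbb{F}_q^n$. The support of a vector is the set of its coordinate positions with nonzero entry. A codeword $\mathbf{c}$ of a linear code $\mathcal{C}$ is minimal if every $\mathbf{b}\in\mathcal{C}$ whose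 support is contained in the support of $\mathbf{c}$ equals $a\mathbf{c}$ for some $a\in\mathbb{F}_q$; the code $\mathcal{C}$ is minimal if all of its codewords are minimal. *)

theory Defs
  imports "HOL-Analysis.Analysis"
begin

text \<open>A monomial in the variables indexed by \<^typ>\<open>'m\<close> is given by its exponent vector
  \<open>b :: 'm \<Rightarrow> nat\<close>.\<close>

definition monomial_fun :: "('m::finite \<Rightarrow> nat) \<Rightarrow> 'a::comm_semiring_1 ^ 'm \<Rightarrow> 'a" where
  "monomial_fun b x = (\<Prod>i\<in>UNIV. (x $ i) ^ b i)"

definition monomial_vars :: "('m \<Rightarrow> nat) \<Rightarrow> 'm set" where
  "monomial_vars b = {i. b i \<noteq> 0}"

text \<open>The coordinate positions of \<open>C_f\<close> are the nonzero vectors of \<open>'a ^ 'm\<close>. They are made into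
  a type of their own, so that the ambient space is the library's vector space
  \<open>'a ^ ('a, 'm) nonzero_vec\<close>, with its \<open>vec.subspace\<close> and \<open>vec.dim\<close>.\<close>

typedef (overloaded) ('a, 'm) nonzero_vec = "{x :: 'a::field ^ 'm::finite. x \<noteq> 0}"
  morphisms the_vec mk_nonzero_vec
proof -
  have "(1 :: 'a ^ 'm) \<noteq> 0"
    by (simp add: vec_eq_iff)
  then show ?thesis
    by blast
qed

instance nonzero_vec :: ("{field, finite}", finite) finite
proof
  have "inj (the_vec :: ('a, 'b) nonzero_vec \<Rightarrow> 'a ^ 'b)"
    by (simp add: inj_on_def the_vec_inject)
  then show "finite (UNIV :: ('a, 'b) nonzero_vec set)"
    by (rule finite_imageD[rotated]) simp
qed

definition code_of ::
  "('a ^ 'm \<Rightarrow> 'a) \<Rightarrow> ('a::{field, finite} ^ ('a, 'm::finite) nonzero_vec) set" where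
  "code_of f =
    {\<chi> p. u * f (the_vec p) + scalar_product v (the_vec p) | (u :: 'a) (v :: 'a ^ 'm). True}"

definition linear_code :: "nat \<Rightarrow> nat \<Rightarrow> ('a::field ^ 'n::finite) set \<Rightarrow> bool" where
  "linear_code n k C \<longleftrightarrow> CARD('n) = n \<and> vec.subspace C \<and> vec.dim C = k"

definition vec_support :: "'a::zero ^ 'n::finite \<Rightarrow> 'n set" where
  "vec_support c = {i. c $ i \<noteq> 0}"

definition minimal_codeword :: "('a::field ^ 'n::finite) set \<Rightarrow> 'a ^ 'n \<Rightarrow> bool" where
  "minimal_codeword C c \<longleftrightarrow>
    c \<in> C \<and> (\<forall>b\<in>C. vec_support b \<subseteq> vec_support c \<longrightarrow> (\<exists>a. b = a *s c))"

definition minimal_code :: "('a::field ^ 'n::finite) set \<Rightarrow> bool" where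
  "minimal_code C \<longleftrightarrow> (\<forall>c\<in>C. minimal_codeword C c)"

end

theory Submission
  imports Defs
begin

text \<open>
  Let the zeros of \<open>c = u f + v \<bullet> x\<close> be zeros of \<open>c' = u' f + v' \<bullet> x\<close>.  If \<open>u \<noteq> 0\<close>, a multiple
  of \<open>c\<close> subtracted from \<open>c'\<close> leaves a linear form vanishing on the zeros of \<open>c\<close>, which must be
  \<open>0\<close>; if \<open>u = 0\<close>, then \<open>u' = 0\<close> unless \<open>f\<close> is linear on the hyperplane \<open>v \<bullet> x = 0\<close>.  Both facts
  about \<open>f\<close> are obtained from vectors supported on the variables of one monomial and one further
  coordinate \<open>i\<close>: there all other monomials vanish, as each involves a variable outside the
  support.  Since there are two monomials with disjoint sets of variables, \<open>i\<close> is arbitrary.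
\<close>

section \<open>Bilinearity and kernels of the scalar product\<close>

lemma
  fixes v w x :: "'a::comm_ring_1 ^ 'n::finite"
  shows scalar_product_diff_left:
      "scalar_product (v - w) x = scalar_product v x - scalar_product w x"
    and scalar_product_smult_left: "scalar_product (c *s v) x = c * scalar_product v x"
    and scalar_product_zero_left [simp]: "scalar_product 0 x = 0"
  by (simp_all add: scalar_product_def sum_subtractf algebra_simps sum_distrib_left)

lemma
  fixes v x y :: "'a::comm_ring_1 ^ 'n::finite"
  shows scalar_product_add_right:
      "scalar_product v (x + y) = scalar_product v x + scalar_product v y"
    and scalar_product_diff_right:
      "scalar_product v (x - y) = scalar_product v x - scalar_product v y"
    and scalar_product_zero_right [simp]: "scalar_product v 0 = 0"
    and scalar_product_axis_right [simp]: "scalar_product v (axis i c) = v $ i * c"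
  by (simp_all add: scalar_product_def sum.distrib sum_subtractf algebra_simps axis_def
      if_distrib[where f = "\<lambda>u. _ * u"] cong: if_cong)

lemma scalar_product_sum_right:
  fixes v :: "'a::comm_ring_1 ^ 'n::finite"
  shows "scalar_product v (sum g A) = (\<Sum>k\<in>A. scalar_product v (g k))"
  unfolding scalar_product_def sum_component sum_distrib_left by (rule sum.swap)

text \<open>Two-coordinate vectors in the kernel of \<open>v\<close> suffice: with
  \<open>v $ p\<close> nonzero, each of them fixes the ratio of \<open>w $ k\<close> to
  \<open>w $ p\<close>.\<close>

lemma proportional_of_kernel_subset:
  fixes v w :: "'a::field ^ 'n::finite"
  assumes "v \<noteq> 0" and sub: "\<And>x. scalar_product v x = 0 \<Longrightarrow> scalar_product w x = 0"
  shows "\<exists>c. w = c *s v"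
proof -
  obtain p where p: "v $ p \<noteq> 0"
    using assms(1) by (auto simp: vec_eq_iff)
  have "w $ k = (w $ p / v $ p) * v $ k" for k
  proof -
    have "w $ k * v $ p = w $ p * v $ k"
      using sub[of "axis k (v $ p) - axis p (v $ k)"]
      by (simp add: scalar_product_diff_right mult.commute)
    then show ?thesis
      using p by (simp add: nonzero_eq_divide_eq)
  qed
  then show ?thesis
    unfolding vec_eq_iff vector_smult_component by blast
qed

section \<open>Supports, length and dimension of the code\<close>

definition codeword ::
  "('a ^ 'm \<Rightarrow> 'a) \<Rightarrow> 'a \<Rightarrow> 'a ^ 'm \<Rightarrow> 'a::{field, finite} ^ ('a, 'm::finite) nonzero_vec" where
  "codeword f u v = (\<chi> p. u * f (the_vec p) + scalar_product v (the_vec p))"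

lemma code_of_eq: "code_of f = {codeword f u v | u v. True}"
  by (simp add: code_of_def codeword_def)

text \<open>The coordinate positions are only the nonzero vectors, but \<open>f 0 = 0\<close> makes
  the implication trivial at the origin, so \<open>x\<close> may range over the whole space.\<close>

lemma vec_support_codeword_subset_iff:
  assumes "f 0 = 0"
  shows "vec_support (codeword f u v) \<subseteq> vec_support (codeword f u' v') \<longleftrightarrow>
    (\<forall>x. u' * f x + scalar_product v' x = 0 \<longrightarrow> u * f x + scalar_product v x = 0)"
    (is "?L \<longleftrightarrow> ?R")
proof
  assume L: ?L
  show ?R
  proof (intro allI impI)
    fix x
    assume *: "u' * f x + scalar_product v' x = 0"
    show "u * f x + scalar_product v x = 0"
    proof (cases "x = 0")
      case False
      then have x: "the_vec (mk_nonzero_vec x) = x"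
        by (simp add: mk_nonzero_vec_inverse)
      have "mk_nonzero_vec x \<in> vec_support (codeword f u v) \<Longrightarrow>
        mk_nonzero_vec x \<in> vec_support (codeword f u' v')"
        using L by blast
      then show ?thesis
        using * by (auto simp: vec_support_def codeword_def x)
    qed (simp add: assms)
  qed
qed (auto simp: vec_support_def codeword_def)

lemma card_nonzero_vec:
  "CARD(('a::{field, finite}, 'm::finite) nonzero_vec) = CARD('a) ^ CARD('m) - 1"
proof -
  interpret type_definition "the_vec :: ('a, 'm) nonzero_vec \<Rightarrow> _" mk_nonzero_vec "{x. x \<noteq> 0}"
    by (rule type_definition_nonzero_vec)
  have "{x :: 'a ^ 'm. x \<noteq> 0} = UNIV - {0}"
    by auto
  then show ?thesis
    by (simp add: card card_Diff_singleton)
qed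

text \<open>The code is the image of a matrix whose columns are the evaluation of \<open>f\<close>
  and the coordinate functions. Its kernel is trivial: a relation with \<open>u\<close> nonzero
  would make \<open>f\<close> a linear form, and one with \<open>u = 0\<close> is a linear form
  vanishing everywhere.\<close>

lemma linear_code_code_of:
  fixes f :: "'a::{field, finite} ^ 'm::finite \<Rightarrow> 'a"
  assumes f0: "f 0 = 0" and nonlinear: "\<And>w. \<exists>x. f x \<noteq> scalar_product w x"
  shows "linear_code (CARD('a) ^ CARD('m) - 1) (CARD('m) + 1) (code_of f)"
proof -
  \<comment> \<open>The index type \<open>'m option\<close> provides exactly m + 1 columns:
    \<open>None\<close> carries the coefficient of \<open>f\<close>, \<open>Some i\<close> the
    coefficient of the i-th variable.\<close>
  define A :: "'a ^ 'm option ^ ('a, 'm) nonzero_vec" where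
    "A = (\<chi> p k. case k of None \<Rightarrow> f (the_vec p) | Some i \<Rightarrow> the_vec p $ i)"
  have A: "A *v z = codeword f (z $ None) (\<chi> i. z $ Some i)" for z
    by (simp add: A_def codeword_def vec_eq_iff matrix_vector_mult_def scalar_product_def
        UNIV_option_conv sum.reindex mult.commute)
  have range: "code_of f = range ((*v) A)"
  proof (intro equalityI subsetI)
    fix c
    assume "c \<in> code_of f"
    then obtain u v where "c = codeword f u v"
      by (auto simp: code_of_eq)
    then have "c = A *v (\<chi> k. case k of None \<Rightarrow> u | Some i \<Rightarrow> v $ i)"
      by (simp add: A)
    then show "c \<in> range ((*v) A)"
      by blast
  qed (auto simp: A code_of_eq)
  have "inj ((*v) A)"
    unfolding vec.inj_iff_eq_0
  proof (intro allI impI)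
    fix z
    assume z: "A *v z = 0"
    define u v where "u = z $ None" and "v = (\<chi> i. z $ Some i)"
    have "codeword f u v = codeword f 0 0"
      using z by (simp add: A u_def v_def) (simp add: codeword_def vec_eq_iff)
    \<comment> \<open>The all-zero codeword has empty support, so the support criterion gives the
      relation at every \<open>x\<close>, the origin included.\<close>
    then have eq: "u * f x + scalar_product v x = 0" for x
      using vec_support_codeword_subset_iff[of f u v 0 0] f0 by simp
    have "u = 0"
    proof (rule ccontr)
      assume "u \<noteq> 0"
      then have "f x = scalar_product ((- 1 / u) *s v) x" for x
        using eq[of x] unfolding scalar_product_smult_left
        by (simp add: field_simps eq_neg_iff_add_eq_0)
      then show False
        using nonlinear by blast
    qed
    moreover have "v = 0"
      using eq[of "axis _ 1"] \<open>u = 0\<close> by (simp add: vec_eq_iff)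
    ultimately show "z = 0"
      unfolding u_def v_def by (simp add: vec_eq_iff) (metis option.exhaust)
  qed
  then have "vec.dim (range ((*v) A)) = CARD('m option)"
    by (subst vec.dim_image_eq) (auto simp only: vec_dim_card matrix_vector_mul_linear_gen
        intro: inj_on_subset)
  moreover have "vec.subspace (range ((*v) A))"
    by (intro vec.linear_subspace_image matrix_vector_mul_linear_gen vec.subspace_UNIV)
  ultimately show ?thesis
    unfolding linear_code_def range by (simp only: card_nonzero_vec card_option Suc_eq_plus1)
qed

section \<open>Reduction of minimality to two properties of f\<close>

lemma minimal_code_code_of:
  fixes f :: "'a::{field, finite} ^ 'm::finite \<Rightarrow> 'a"
  assumes f0: "f 0 = 0"
    and nonlinear: "\<And>v w. v \<noteq> 0 \<Longrightarrow> \<exists>x. scalar_product v x = 0 \<and> f x \<noteq> scalar_product w x"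
    and zeros: "\<And>v w. w \<noteq> 0 \<Longrightarrow> \<exists>x. f x + scalar_product v x = 0 \<and> scalar_product w x \<noteq> 0"
  shows "minimal_code (code_of f)"
proof -
  have "\<exists>k. codeword f u' v' = k *s codeword f u v"
    if "vec_support (codeword f u' v') \<subseteq> vec_support (codeword f u v)" for u v u' v'
  proof -
    have sub: "u' * f x + scalar_product v' x = 0" if "u * f x + scalar_product v x = 0" for x
      using that \<open>vec_support _ \<subseteq> _\<close> vec_support_codeword_subset_iff[of f, OF f0] by blast
    have eqI: "\<exists>k. codeword f u' v' = k *s codeword f u v" if "u' = k * u" "v' = k *s v" for k
      unfolding that codeword_def scalar_product_smult_left
      by (intro exI[of _ k]) (simp add: vec_eq_iff distrib_left mult.assoc)
    show ?thesis
    proof (cases "u = 0")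
      case True
      show ?thesis
      proof (cases "v = 0")
        case True
        then have "u' * f x + scalar_product v' x = 0" for x
          using sub[of x] \<open>u = 0\<close> by simp
        then have "codeword f u' v' = 0 *s codeword f u v"
          by (simp add: codeword_def vec_eq_iff)
        then show ?thesis ..
      next
        case False
        \<comment> \<open>Otherwise, on the hyperplane orthogonal to \<open>v\<close>,
          \<open>f\<close> would agree with the linear form given by
          \<open>- v' / u'\<close>.\<close>
        have "u' = 0"
        proof (rule ccontr)
          assume "u' \<noteq> 0"
          obtain x where x: "scalar_product v x = 0" "f x \<noteq> scalar_product ((- 1 / u') *s v') x"
            using nonlinear[OF False] by blast
          with sub[of x] \<open>u = 0\<close> \<open>u' \<noteq> 0\<close> show False
            unfolding scalar_product_smult_left
            by (simp add: field_simps eq_neg_iff_add_eq_0)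
        qed
        moreover obtain k where "v' = k *s v"
          using proportional_of_kernel_subset[OF False, of v'] sub \<open>u = 0\<close> \<open>u' = 0\<close> by auto
        ultimately show ?thesis
          using eqI[of k] \<open>u = 0\<close> by simp
      qed
    next
      case False
      define k where "k = u' / u"
      have u': "u' = k * u"
        using False by (simp add: k_def)
      \<comment> \<open>With \<open>k = u' / u\<close> the multiples of \<open>f\<close> cancel, and
        the remaining linear form vanishes on the zeros of \<open>u * f + v\<close>. Dividing by
        \<open>u\<close> keeps these zeros and puts them in the form required by
        \<open>zeros\<close>.\<close>
      have "v' - k *s v = 0"
      proof (rule ccontr)
        assume "v' - k *s v \<noteq> 0"
        then obtain x where x: "f x + scalar_product ((1 / u) *s v) x = 0"
          "scalar_product (v' - k *s v) x \<noteq> 0"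
          using zeros by blast
        from x(1) have x1: "u * f x + scalar_product v x = 0"
          using False unfolding scalar_product_smult_left by (simp add: field_simps)
        have "scalar_product (v' - k *s v) x =
          (u' * f x + scalar_product v' x) - k * (u * f x + scalar_product v x)"
          by (simp add: u' scalar_product_diff_left scalar_product_smult_left algebra_simps)
        with sub[OF x1] x1 x(2) show False
          by simp
      qed
      then show ?thesis
        using eqI[OF u'] by simp
    qed
  qed
  then show ?thesis
    unfolding minimal_code_def minimal_codeword_def code_of_eq by blast
qed

section \<open>Sums of products over disjoint sets of variables\<close>

lemma monomial_fun_squarefree:
  assumes "\<And>i. b i \<in> {0, 1}"
  shows "monomial_fun b x = (\<Prod>i\<in>monomial_vars b. x $ i)"
  unfolding monomial_fun_def
proof (rule prod.mono_neutral_cong_right)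
  show "x $ i ^ b i = x $ i" if "i \<in> monomial_vars b" for i
    using that assms[of i] by (auto simp: monomial_vars_def)
qed (auto simp: monomial_vars_def)

text \<open>Exponents in {0, 1} reduce a monomial to its set of variables, so only the sets
  \<open>V j\<close> are kept.\<close>

locale disjoint_products =
  fixes I :: "'j set" and a :: "'j \<Rightarrow> 'a::field" and V :: "'j \<Rightarrow> 'm::finite set"
    and f :: "'a ^ 'm \<Rightarrow> 'a"
  assumes card_I: "card I \<ge> 2"
    and f_eq: "f x = (\<Sum>j\<in>I. a j * (\<Prod>i\<in>V j. x $ i))"
    and coeff_nonzero: "j \<in> I \<Longrightarrow> a j \<noteq> 0"
    and disjoint: "disjoint_family_on V I"
    and card_V: "j \<in> I \<Longrightarrow> card (V j) \<ge> 2"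
begin

lemma obtain_avoiding:
  obtains j where "j \<in> I" "i \<notin> V j"
proof -
  obtain j k where "j \<in> I" "k \<in> I" "j \<noteq> k"
    using card_I by (metis card_2_iff' obtain_subset_with_card_n subset_iff)
  then show thesis
    using that disjoint by (cases "i \<in> V j") (auto simp: disjoint_family_on_def)
qed

lemma obtain_other_var:
  assumes "j \<in> I"
  obtains k where "k \<in> V j" "k \<noteq> i"
  using card_V[OF assms] by (metis card_2_iff' obtain_subset_with_card_n subset_iff)

text \<open>Any other \<open>V l\<close> has at least two elements, hence one different from
  \<open>i\<close>; by disjointness it lies outside \<open>V j\<close> as well, so \<open>x\<close>
  vanishes there and the product over \<open>V l\<close> is 0. The extra coordinate \<open>i\<close>
  can therefore be chosen freely.\<close>

lemma eval:
  assumes j: "j \<in> I" and supp: "\<And>k. x $ k \<noteq> 0 \<Longrightarrow> k = i \<or> k \<in> V j"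
  shows "f x = a j * (\<Prod>k\<in>V j. x $ k)"
proof -
  have "(\<Prod>k\<in>V l. x $ k) = 0" if l: "l \<in> I" "l \<noteq> j" for l
  proof -
    obtain k where k: "k \<in> V l" "k \<noteq> i"
      using obtain_other_var[OF l(1)] .
    then have "x $ k = 0"
      using supp[of k] disjoint j l by (auto simp: disjoint_family_on_def)
    with k(1) show ?thesis
      by (auto intro: prod_zero)
  qed
  moreover have "finite I"
    using card_I by (metis card.infinite not_numeral_le_zero)
  ultimately show ?thesis
    unfolding f_eq using j by (simp add: sum.remove[of _ j] del: prod_zero_iff)
qed

text \<open>The product over \<open>V j\<close> also vanishes: \<open>V j\<close> has a second
  element besides \<open>l\<close>, and it differs from \<open>i\<close> since \<open>i\<close> is
  outside \<open>V j\<close>.\<close>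

lemma eval_zero:
  assumes i: "j \<in> I" "i \<notin> V j" and l: "l \<in> V j"
  shows "f (axis l c + axis i d) = 0"
proof -
  obtain k where k: "k \<in> V j" "k \<noteq> l"
    using obtain_other_var[OF i(1)] .
  have "f (axis l c + axis i d) = a j * (\<Prod>k\<in>V j. (axis l c + axis i d) $ k)"
    by (rule eval[OF i(1)]) (use l in \<open>auto simp: axis_def split: if_splits\<close>)
  also have "(\<Prod>k\<in>V j. (axis l c + axis i d) $ k) = 0"
    using k i by (intro prod_zero bexI[of _ k]) (auto simp: axis_def)
  finally show ?thesis
    by simp
qed

text \<open>The entry \<open>c\<close> at \<open>i\<close> leaves the value of \<open>f\<close>
  unchanged, so it can be used to adjust a linear form.\<close>

lemma eval_one:
  assumes i: "j \<in> I" "i \<notin> V j"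
    and x: "\<And>k. x $ k = (if k \<in> V j then 1 else if k = i then c else 0)"
  shows "f x = a j"
proof -
  have "f x = a j * (\<Prod>k\<in>V j. x $ k)"
    by (rule eval[OF i(1)]) (auto simp: x split: if_splits)
  then show ?thesis
    by (simp add: x)
qed

text \<open>Unit vectors in the directions of \<open>V j\<close> are moved into the hyperplane by a
  correction along one axis \<open>p\<close> outside \<open>V j\<close>. On each of them
  \<open>f\<close> is 0, on their sum it is \<open>a j\<close>, which is incompatible with
  linearity.\<close>

lemma nonlinear_on_hyperplane:
  assumes "v \<noteq> 0"
  shows "\<exists>x. scalar_product v x = 0 \<and> f x \<noteq> scalar_product w x"
proof (rule ccontr)
  assume "\<not> ?thesis"
  then have lin: "f x = scalar_product w x" if "scalar_product v x = 0" for x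
    using that by blast
  obtain p where p: "v $ p \<noteq> 0"
    using assms by (auto simp: vec_eq_iff)
  obtain j where j: "j \<in> I" "p \<notin> V j"
    using obtain_avoiding .
  define e :: "'m \<Rightarrow> 'a ^ 'm" where "e k = axis k 1 + axis p (- v $ k / v $ p)" for k
  have v: "scalar_product v (e k) = 0" for k
    using p by (simp add: e_def scalar_product_add_right)
  have w: "scalar_product w (e k) = 0" if "k \<in> V j" for k
    using lin[OF v, of k] eval_zero[OF j that, of 1 "- v $ k / v $ p"] by (metis e_def)
  let ?x = "\<Sum>k\<in>V j. e k"
  \<comment> \<open>All corrections accumulate in the single coordinate \<open>p\<close>, so the sum
    has the shape needed for \<open>eval_one\<close>.\<close>
  have "?x $ k = (if k \<in> V j then 1 else if k = p then \<Sum>k\<in>V j. - v $ k / v $ p else 0)" for k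
    using j(2) by (simp add: e_def axis_def sum.distrib)
  then have "f ?x = a j"
    by (rule eval_one[OF j])
  moreover have "f ?x = 0"
    using lin[of ?x] v w by (simp add: scalar_product_sum_right)
  ultimately show False
    using coeff_nonzero[OF j(1)] by simp
qed

text \<open>For each \<open>i\<close>, a monomial avoiding \<open>i\<close> supplies two kinds of
  zeros of \<open>f + v\<close>: two-coordinate vectors, where \<open>f\<close> itself vanishes, and
  one vector where \<open>f\<close> equals \<open>a j\<close>. The first kind ties \<open>w\<close>
  to \<open>v\<close> on \<open>V j\<close> and \<open>i\<close>; the second then leaves only
  \<open>w $ i = 0\<close>.\<close>

lemma zero_off_hyperplane:
  assumes "w \<noteq> 0"
  shows "\<exists>x. f x + scalar_product v x = 0 \<and> scalar_product w x \<noteq> 0"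
proof (rule ccontr)
  assume "\<not> ?thesis"
  then have zero: "scalar_product w x = 0" if "f x + scalar_product v x = 0" for x
    using that by blast
  have "w $ i = 0" for i
  proof -
    obtain j where j: "j \<in> I" "i \<notin> V j"
      using obtain_avoiding .
    have pair: "w $ l * c + w $ i * d = 0" if "l \<in> V j" "v $ l * c + v $ i * d = 0" for l c d
      using zero[of "axis l c + axis i d"] eval_zero[OF j that(1)] that(2)
      by (simp add: scalar_product_add_right)
    show ?thesis
    proof (cases "v $ i = 0")
      case True
      obtain l where "l \<in> V j"
        using obtain_other_var[OF j(1)] .
      then show ?thesis
        \<comment> \<open>Here the unit vector along \<open>i\<close> is itself a zero of
          \<open>f + v\<close>.\<close>
        using pair[of l 0 1] True by simp
    next
      case False
      define s where "s u = (\<Sum>l\<in>V j. u $ l)" for u :: "'a ^ 'm"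
      have "w $ l * v $ i = v $ l * w $ i" if "l \<in> V j" for l
        using pair[OF that, of "v $ i" "- v $ l"] by (simp add: algebra_simps)
      then have proportional: "s w * v $ i = s v * w $ i"
        by (simp add: s_def sum_distrib_right)
      \<comment> \<open>This \<open>c\<close> solves \<open>a j + s v + v $ i * c = 0\<close>, which
        makes the vector \<open>x\<close> defined next a zero of \<open>f + v\<close>.\<close>
      define c where "c = - (a j + s v) / v $ i"
      define x where "x = (\<Sum>l\<in>V j. axis l 1) + axis i c"
      have sp: "scalar_product u x = s u + u $ i * c" for u
        by (simp add: x_def s_def scalar_product_add_right scalar_product_sum_right)
      have "x $ k = (if k \<in> V j then 1 else if k = i then c else 0)" for k
        using j(2) by (simp add: x_def axis_def)
      then have "f x = a j"
        by (rule eval_one[OF j])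
      then have "scalar_product w x = 0"
        using False by (intro zero) (simp add: sp c_def)
      then have "s w * v $ i = (a j + s v) * w $ i"
        using False by (simp add: sp c_def field_simps)
      \<comment> \<open>The two expressions for \<open>s w * v $ i\<close> differ exactly by
        \<open>a j * w $ i\<close>.\<close>
      with proportional have "a j * w $ i = 0"
        by (simp add: algebra_simps)
      then show ?thesis
        using coeff_nonzero[OF j(1)] by simp
    qed
  qed
  then show False
    using assms by (simp add: vec_eq_iff)
qed

lemma at_zero: "f 0 = 0"
proof -
  obtain j where "j \<in> I"
    using obtain_avoiding .
  then show ?thesis
    using eval[of j 0] card_V[of j] by (auto simp: power_0_left)
qed

end

theorem theorem7p2:
  fixes f :: "'a::{field, finite} ^ 'm::finite \<Rightarrow> 'a"
    and t :: nat
    and a :: "nat \<Rightarrow> 'a"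
    and b :: "nat \<Rightarrow> 'm \<Rightarrow> nat"
  assumes "t \<ge> 2"
    and "\<And>x. f x = (\<Sum>j=1..t. a j * monomial_fun (b j) x)"
    and "\<And>j. j \<in> {1..t} \<Longrightarrow> a j \<noteq> 0"
    and "disjoint_family_on (\<lambda>j. monomial_vars (b j)) {1..t}"
    and "\<And>j. j \<in> {1..t} \<Longrightarrow> card (monomial_vars (b j)) \<ge> 2"
    and "\<And>j i. j \<in> {1..t} \<Longrightarrow> b j i \<in> {0, 1}"
  shows "linear_code (CARD('a) ^ CARD('m) - 1) (CARD('m) + 1) (code_of f) \<and>
    minimal_code (code_of f)"
proof -
  interpret disjoint_products "{1..t}" a "\<lambda>j. monomial_vars (b j)" f
  proof
    show "f x = (\<Sum>j=1..t. a j * (\<Prod>i\<in>monomial_vars (b j). x $ i))" for x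
      unfolding assms(2)
      by (intro sum.cong refl arg_cong[where f = "(*) _"] monomial_fun_squarefree assms(6))
  qed (use assms in auto)
  have "\<exists>x. f x \<noteq> scalar_product w x" for w
    \<comment> \<open>Any nonzero vector would do for the hyperplane; the all-ones vector is
      taken.\<close>
    using nonlinear_on_hyperplane[of 1 w] by (auto simp: vec_eq_iff)
  then show ?thesis
    using linear_code_code_of minimal_code_code_of at_zero nonlinear_on_hyperplane
      zero_off_hyperplane by blast
qed

end
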